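(* Let $m\geq 3$ and $n$ be even positive integers. Then the stacked-book graph $G_{m,n}=S_m\Box P_n$ satisfies $$rn(G_{m,n})\leq \frac{mn^2}{2}+n-1.$$
   Context: $S_m$ denotes the star on $m$ vertices (one center vertex adjacent to $m-1$ leaves), $m\ge 3$, and $P_n$ the path on $n$ vertices. The stacked-book graph $G_{m,n}=S_m \Box P_n$ is their Cartesian product. For a simple connected graph $G$ with distance $d$ and diameter $\mathrm{diam}(G)$, a radio labeling is a function $f:V(G)\to \mathbb{Z}_{\ge 0}$ such that $|f(u)-f(v)|\geq \mathrm{diam}(G)+1-d(u,v)$ for all distinct $u,v\in V(G)$. The span of $f$ is $\max_{v} f(v)-\min_{v} f(v)$. The radio number $rn(G)$ is the minimum span over all radio labelings of $G$. *)

theory Defs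
  imports Complex_Main "Graph_Theory.Graph_Theory"
begin

text \<open>
  Simple graphs are modelled as in \<^theory>\<open>Graph_Theory.Pair_Digraph\<close>: an undirected edge is a
  pair of opposite arcs.
\<close>

definition star_graph :: "nat \<Rightarrow> nat pair_pre_digraph" where
  "star_graph m = \<lparr>pverts = {0..<m}, parcs = {0} \<times> {1..<m} \<union> {1..<m} \<times> {0}\<rparr>"

definition path_graph :: "nat \<Rightarrow> nat pair_pre_digraph" where
  "path_graph n =
     \<lparr>pverts = {0..<n}, parcs = {(i, j). i < n \<and> j < n \<and> (j = Suc i \<or> i = Suc j)}\<rparr>"

definition cartesian_product ::
    "'a pair_pre_digraph \<Rightarrow> 'b pair_pre_digraph \<Rightarrow> ('a \<times> 'b) pair_pre_digraph" where
  "cartesian_product G H =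
     \<lparr>pverts = pverts G \<times> pverts H,
      parcs = {((u, x), (v, y)) | u x v y.
                 (u = v \<and> u \<in> pverts G \<and> (x, y) \<in> parcs H) \<or>
                 ((u, v) \<in> parcs G \<and> x = y \<and> x \<in> pverts H)}\<rparr>"

definition stacked_book :: "nat \<Rightarrow> nat \<Rightarrow> (nat \<times> nat) pair_pre_digraph" where
  "stacked_book m n = cartesian_product (star_graph m) (path_graph n)"

text \<open>The following notions are meant for finite nonempty connected graphs only.\<close>

definition graph_dist :: "'a pair_pre_digraph \<Rightarrow> 'a \<Rightarrow> 'a \<Rightarrow> nat" where
  "graph_dist G u v = (LEAST k. \<exists>p. pre_digraph.awalk (with_proj G) u p v \<and> length p = k)"

definition graph_diam :: "'a pair_pre_digraph \<Rightarrow> nat" where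
  "graph_diam G = Max {graph_dist G u v | u v. u \<in> pverts G \<and> v \<in> pverts G}"

definition radio_labeling :: "'a pair_pre_digraph \<Rightarrow> ('a \<Rightarrow> nat) \<Rightarrow> bool" where
  "radio_labeling G f \<longleftrightarrow>
     (\<forall>u \<in> pverts G. \<forall>v \<in> pverts G. u \<noteq> v \<longrightarrow>
        \<bar>int (f u) - int (f v)\<bar> \<ge> int (graph_diam G) + 1 - int (graph_dist G u v))"

definition label_span :: "'a pair_pre_digraph \<Rightarrow> ('a \<Rightarrow> nat) \<Rightarrow> nat" where
  "label_span G f = Max (f ` pverts G) - Min (f ` pverts G)"

definition radio_number :: "'a pair_pre_digraph \<Rightarrow> nat" where
  "radio_number G = (LEAST k. \<exists>f. radio_labeling G f \<and> label_span G f = k)"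

lemma pair_graph_stacked_book: "pair_graph (stacked_book m n)"
proof -
  let ?G = "stacked_book m n"
  have V: "pverts ?G = {0..<m} \<times> {0..<n}"
    by (simp add: stacked_book_def cartesian_product_def star_graph_def path_graph_def)
  have sub: "parcs ?G \<subseteq> pverts ?G \<times> pverts ?G"
    by (auto simp: stacked_book_def cartesian_product_def star_graph_def path_graph_def)
  have fin: "finite (parcs ?G)"
    by (rule finite_subset[OF sub]) (simp add: V)
  show ?thesis
  proof
    show "symmetric (with_proj ?G)"
      by (auto simp: symmetric_def sym_def stacked_book_def cartesian_product_def
            star_graph_def path_graph_def)
    show "fst e \<noteq> snd e" if "e \<in> parcs ?G" for e
      using that by (auto simp: stacked_book_def cartesian_product_def
            star_graph_def path_graph_def)
  qed (use sub fin V in auto)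
qed

end

theory Submission
  imports Defs
begin

text \<open>
  Write \<open>n = 2 k\<close> and let \<open>h v\<close> be the distance from \<open>v\<close> to the central edge, which joins the
  centres of the two middle stars.  Vertices \<open>u\<close>, \<open>v\<close> on different sides of this edge have distance
  \<open>h u + h v + 1\<close>, unless they are copies of the same leaf.  Visit the vertices alternately on both
  sides, upwards level by level on each side, starting and ending at the central edge, and
  let consecutive labels differ by as little as the radio condition for consecutive vertices allows.
  The gaps \<open>diam G - h u - h v\<close> then telescope, so the span depends only on the sum of all \<open>h v\<close>.
  Three successive gaps always suffice for the radio condition, and two do because
  leaves visited two steps apart differ.
\<close>

subsection \<open>Distances in graphs\<close>

definition distance_function :: "'a pair_pre_digraph \<Rightarrow> 'a \<Rightarrow> ('a \<Rightarrow> nat) \<Rightarrow> bool" where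
  "distance_function G v \<delta> \<longleftrightarrow>
     (\<forall>w \<in> pverts G. \<delta> w = 0 \<longleftrightarrow> w = v) \<and>
     (\<forall>(w, w') \<in> parcs G. \<delta> w \<le> Suc (\<delta> w')) \<and>
     (\<forall>w \<in> pverts G. w \<noteq> v \<longrightarrow> (\<exists>w'. (w, w') \<in> parcs G \<and> \<delta> w = Suc (\<delta> w')))"

context pair_wf_digraph
begin

lemma distance_function_imp_awalk:
  assumes "distance_function G v \<delta>" "u \<in> pverts G"
  shows "\<exists>p. awalk u p v \<and> length p = \<delta> u"
  using assms(2)
proof (induction "\<delta> u" arbitrary: u)
  case 0
  then have "u = v" using assms(1) by (auto simp: distance_function_def)
  with 0 show ?case by (intro exI[of _ "[]"]) (simp add: awalk_Nil_iff)
next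
  case (Suc d)
  then obtain w where w: "(u, w) \<in> parcs G" "\<delta> u = Suc (\<delta> w)"
    using assms(1) by (fastforce simp: distance_function_def)
  then have "w \<in> pverts G" using in_arcsD2 by blast
  then obtain p where "awalk w p v" "length p = \<delta> w" using Suc w(2) by auto
  with w show ?case
    by (intro exI[of _ "(u, w) # p"]) (simp add: awalk_Cons_iff)
qed

lemma distance_function_le_length_awalk:
  assumes "distance_function G v \<delta>" "awalk u p v"
  shows "\<delta> u \<le> length p"
  using assms(2)
proof (induction p arbitrary: u)
  case Nil
  then show ?case using assms(1) by (auto simp: distance_function_def awalk_Nil_iff)
next
  case (Cons e p)
  then have e: "(u, snd e) \<in> parcs G" "awalk (snd e) p v" by (auto simp: awalk_Cons_iff)
  then have "\<delta> u \<le> Suc (\<delta> (snd e))" using assms(1) by (auto simp: distance_function_def)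
  also have "\<dots> \<le> length (e # p)" using Cons.IH[OF e(2)] by simp
  finally show ?case .
qed

lemma graph_dist_eq_distance_function:
  assumes "distance_function G v \<delta>" "u \<in> pverts G"
  shows "graph_dist G u v = \<delta> u"
  unfolding graph_dist_def
proof (rule Least_equality)
  show "\<exists>p. awalk u p v \<and> length p = \<delta> u"
    by (rule distance_function_imp_awalk[OF assms])
  show "\<delta> u \<le> k" if "\<exists>p. awalk u p v \<and> length p = k" for k
    using that distance_function_le_length_awalk[OF assms(1)] by blast
qed

lemma graph_dist_pos:
  assumes "u \<rightarrow>\<^sup>*\<^bsub>with_proj G\<^esub> v" "u \<noteq> v"
  shows "0 < graph_dist G u v"
proof -
  have "\<exists>k p. awalk u p v \<and> length p = k" using assms(1) by (simp add: reachable_awalk)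
  then have "\<exists>p. awalk u p v \<and> length p = graph_dist G u v"
    unfolding graph_dist_def by (rule LeastI_ex)
  then obtain p where p: "awalk u p v" "length p = graph_dist G u v" by blast
  then have "p \<noteq> []" using assms(2) by (auto simp: awalk_Nil_iff)
  then show ?thesis by (simp flip: p(2))
qed

end

lemma length_rev_path: "length (rev_path p) = length p"
  by (induction p) simp_all

lemma (in pair_sym_digraph) graph_dist_commute: "graph_dist G u v = graph_dist G v u"
proof -
  have "(\<exists>p. awalk u p v \<and> length p = k) \<longleftrightarrow> (\<exists>p. awalk v p u \<and> length p = k)" for k
    by (metis awalk_rev_path length_rev_path)
  then show ?thesis by (simp add: graph_dist_def)
qed

lemma distance_function_cartesian_product:
  assumes "distance_function G a \<delta>" "distance_function H b \<epsilon>"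
  shows "distance_function (cartesian_product G H) (a, b) (\<lambda>(u, x). \<delta> u + \<epsilon> x)"
  unfolding distance_function_def
proof (intro conjI ballI impI)
  fix w assume "w \<in> pverts (cartesian_product G H)"
  then obtain u x where w: "w = (u, x)" "u \<in> pverts G" "x \<in> pverts H"
    by (auto simp: cartesian_product_def)
  then show "(case w of (u, x) \<Rightarrow> \<delta> u + \<epsilon> x) = 0 \<longleftrightarrow> w = (a, b)"
    using assms by (auto simp: distance_function_def)
  assume "w \<noteq> (a, b)"
  then consider "u \<noteq> a" | "x \<noteq> b" using w(1) by blast
  then show "\<exists>w'. (w, w') \<in> parcs (cartesian_product G H) \<and>
      (case w of (u, x) \<Rightarrow> \<delta> u + \<epsilon> x) = Suc (case w' of (u, x) \<Rightarrow> \<delta> u + \<epsilon> x)"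
  proof cases
    case 1
    then obtain u' where "(u, u') \<in> parcs G" "\<delta> u = Suc (\<delta> u')"
      using assms(1) w(2) by (auto simp: distance_function_def)
    then show ?thesis using w by (intro exI[of _ "(u', x)"]) (simp add: cartesian_product_def)
  next
    case 2
    then obtain x' where "(x, x') \<in> parcs H" "\<epsilon> x = Suc (\<epsilon> x')"
      using assms(2) w(3) by (auto simp: distance_function_def)
    then show ?thesis using w by (intro exI[of _ "(u, x')"]) (simp add: cartesian_product_def)
  qed
next
  fix e assume "e \<in> parcs (cartesian_product G H)"
  then show "case e of (w, w') \<Rightarrow>
      (case w of (u, x) \<Rightarrow> \<delta> u + \<epsilon> x) \<le> Suc (case w' of (u, x) \<Rightarrow> \<delta> u + \<epsilon> x)"
    using assms by (fastforce simp: distance_function_def cartesian_product_def)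
qed

subsection \<open>Radio labelings from vertex orderings\<close>

definition radio_gap :: "'a pair_pre_digraph \<Rightarrow> 'a \<Rightarrow> 'a \<Rightarrow> nat" where
  "radio_gap G u v = graph_diam G + 1 - graph_dist G u v"

definition greedy_label :: "'a pair_pre_digraph \<Rightarrow> (nat \<Rightarrow> 'a) \<Rightarrow> nat \<Rightarrow> nat" where
  "greedy_label G x t = (\<Sum>i<t. radio_gap G (x i) (x (Suc i)))"

lemma greedy_label_add:
  assumes "s \<le> t"
  shows "greedy_label G x s + (\<Sum>i=s..<t. radio_gap G (x i) (x (Suc i))) = greedy_label G x t"
  using assms unfolding greedy_label_def lessThan_atLeast0 by (simp add: sum.atLeastLessThan_concat)

lemma greedy_label_mono: "s \<le> t \<Longrightarrow> greedy_label G x s \<le> greedy_label G x t"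
  using greedy_label_add[of s t G x] by linarith

lemma sum_plus_twice_sum_telescope:
  fixes g h :: "nat \<Rightarrow> 'a::comm_semiring_1"
  assumes "\<And>i. i < N \<Longrightarrow> g i + h i + h (Suc i) = d"
  shows "(\<Sum>i<N. g i) + 2 * (\<Sum>i\<le>N. h i) = of_nat N * d + h 0 + h N"
  using assms
proof (induction N)
  case (Suc N)
  have IH: "(\<Sum>i<N. g i) + 2 * (\<Sum>i\<le>N. h i) = of_nat N * d + h 0 + h N"
    by (intro Suc.IH Suc.prems) simp
  have "(\<Sum>i<Suc N. g i) + 2 * (\<Sum>i\<le>Suc N. h i)
      = ((\<Sum>i<N. g i) + 2 * (\<Sum>i\<le>N. h i)) + g N + 2 * h (Suc N)"
    by (simp add: algebra_simps)
  also have "\<dots> = of_nat N * d + h 0 + (g N + h N + h (Suc N)) + h (Suc N)"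
    unfolding IH by (simp add: ac_simps mult_2)
  also have "g N + h N + h (Suc N) = d" by (rule Suc.prems) simp
  finally show ?case by (simp add: algebra_simps)
qed (simp add: mult_2)

context pair_pseudo_graph
begin

lemma radio_labeling_greedy_label:
  assumes x: "bij_betw x {..N} (pverts G)"
    and radio: "\<And>s t. s < t \<Longrightarrow> t \<le> N \<Longrightarrow>
      greedy_label G x s + radio_gap G (x s) (x t) \<le> greedy_label G x t"
  shows "radio_labeling G (greedy_label G x \<circ> inv_into {..N} x)"
  unfolding radio_labeling_def
proof (intro ballI impI)
  define pos where "pos = inv_into {..N} x"
  have pos: "pos v \<le> N" "x (pos v) = v" if "v \<in> pverts G" for v
    using that x bij_betwE[OF bij_betw_inv_into[OF x]]
    by (auto simp: pos_def bij_betw_inv_into_right)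
  have gap: "greedy_label G x (pos u) + radio_gap G u v \<le> greedy_label G x (pos v)"
    if "u \<in> pverts G" "v \<in> pverts G" "pos u < pos v" for u v
    using radio[OF that(3)] pos that by simp
  fix u v assume uv: "u \<in> pverts G" "v \<in> pverts G" "u \<noteq> v"
  have "pos u \<noteq> pos v" using uv pos(2) by metis
  then have "radio_gap G u v \<le> \<bar>int (greedy_label G x (pos u)) - int (greedy_label G x (pos v))\<bar>"
    using gap[of u v] gap[of v u] uv graph_dist_commute[of u v]
    by (cases "pos u" "pos v" rule: linorder_cases) (auto simp: radio_gap_def)
  then show "int (graph_diam G) + 1 - int (graph_dist G u v)
      \<le> \<bar>int ((greedy_label G x \<circ> inv_into {..N} x) u)
        - int ((greedy_label G x \<circ> inv_into {..N} x) v)\<bar>"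
    by (simp add: radio_gap_def pos_def)
qed

lemma radio_number_le_greedy_label:
  assumes x: "bij_betw x {..N} (pverts G)"
    and radio: "\<And>s t. s < t \<Longrightarrow> t \<le> N \<Longrightarrow>
      greedy_label G x s + radio_gap G (x s) (x t) \<le> greedy_label G x t"
  shows "radio_number G \<le> greedy_label G x N"
proof -
  let ?f = "greedy_label G x \<circ> inv_into {..N} x"
  have "radio_labeling G ?f" using x radio by (rule radio_labeling_greedy_label)
  then have "radio_number G \<le> label_span G ?f"
    unfolding radio_number_def by (intro Least_le) auto
  also have "\<dots> \<le> Max (?f ` pverts G)" by (simp add: label_span_def)
  also have "\<dots> \<le> greedy_label G x N"
  proof (rule Max.boundedI)
    show "?f ` pverts G \<noteq> {}" using x by (auto simp: bij_betw_def)
    show "l \<le> greedy_label G x N" if "l \<in> ?f ` pverts G" for l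
      using that bij_betwE[OF bij_betw_inv_into[OF x]] by (auto intro: greedy_label_mono)
  qed simp
  finally show ?thesis .
qed

lemma radio_number_le_greedy_label_if_large_gaps:
  assumes connected: "strongly_connected (with_proj G)"
    and x: "bij_betw x {..N} (pverts G)"
    and gap: "\<And>t. t < N \<Longrightarrow> g \<le> radio_gap G (x t) (x (Suc t))"
    and diam: "graph_diam G \<le> 3 * g"
    and two_steps: "\<And>t. t + 2 \<le> N \<Longrightarrow> radio_gap G (x t) (x (t + 2))
      \<le> radio_gap G (x t) (x (t + 1)) + radio_gap G (x (t + 1)) (x (t + 2))"
  shows "radio_number G \<le> greedy_label G x N"
proof (rule radio_number_le_greedy_label[OF x])
  fix s t assume st: "s < t" "t \<le> N"
  then consider "t = Suc s" | "t = s + 2" | "s + 3 \<le> t" by linarith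
  then have "radio_gap G (x s) (x t) \<le> (\<Sum>i=s..<t. radio_gap G (x i) (x (Suc i)))"
  proof cases
    case 3
    have "x s \<in> pverts G" "x t \<in> pverts G" "x s \<noteq> x t"
      using x st by (auto simp: bij_betw_def inj_on_def)
    then have "0 < graph_dist G (x s) (x t)"
      using connected by (intro graph_dist_pos) (auto simp: strongly_connected_def)
    then have "radio_gap G (x s) (x t) \<le> 3 * g" using diam by (simp add: radio_gap_def)
    also have "\<dots> \<le> (t - s) * g" using 3 by (intro mult_le_mono1) simp
    also have "\<dots> = (\<Sum>i=s..<t. g)" by simp
    also have "\<dots> \<le> (\<Sum>i=s..<t. radio_gap G (x i) (x (Suc i)))"
      using gap st by (intro sum_mono) auto
    finally show ?thesis .
  qed (use st two_steps[of s] in \<open>simp_all add: numeral_2_eq_2\<close>)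
  then show "greedy_label G x s + radio_gap G (x s) (x t) \<le> greedy_label G x t"
    using greedy_label_add[of s t G x] st by simp
qed

lemma radio_number_le_weighted_ordering:
  fixes h :: "'a \<Rightarrow> nat"
  assumes connected: "strongly_connected (with_proj G)"
    and x: "bij_betw x {..N} (pverts G)"
    and dist_Suc: "\<And>t. t < N \<Longrightarrow> graph_dist G (x t) (x (Suc t)) = h (x t) + h (x (Suc t)) + 1"
    and weight: "\<And>t. t < N \<Longrightarrow> h (x t) + h (x (Suc t)) + g \<le> graph_diam G"
    and diam: "graph_diam G \<le> 3 * g"
    and two_steps: "\<And>t. t + 2 \<le> N \<Longrightarrow> h (x t) + 2 * h (x (t + 1)) + h (x (t + 2)) + 1
      \<le> graph_diam G + graph_dist G (x t) (x (t + 2))"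
  shows "radio_number G + 2 * (\<Sum>v \<in> pverts G. h v) \<le> N * graph_diam G + h (x 0) + h (x N)"
proof -
  have gap: "radio_gap G (x t) (x (Suc t)) + h (x t) + h (x (Suc t)) = graph_diam G"
    if "t < N" for t
    using dist_Suc[OF that] weight[OF that] by (simp add: radio_gap_def)
  have "radio_number G \<le> greedy_label G x N"
  proof (rule radio_number_le_greedy_label_if_large_gaps[OF connected x _ diam])
    show "g \<le> radio_gap G (x t) (x (Suc t))" if "t < N" for t
      using gap[OF that] weight[OF that] by simp
    show "radio_gap G (x t) (x (t + 2))
        \<le> radio_gap G (x t) (x (t + 1)) + radio_gap G (x (t + 1)) (x (t + 2))" if "t + 2 \<le> N" for t
      using gap[of t] gap[of "t + 1"] two_steps[OF that] that by (simp add: radio_gap_def)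
  qed
  moreover have "(\<Sum>v \<in> pverts G. h v) = (\<Sum>i\<le>N. h (x i))"
    by (rule sum.reindex_bij_betw[OF x, symmetric])
  moreover have "greedy_label G x N + 2 * (\<Sum>i\<le>N. h (x i))
      = N * graph_diam G + h (x 0) + h (x N)"
    using sum_plus_twice_sum_telescope[of N "\<lambda>i. radio_gap G (x i) (x (Suc i))" "h \<circ> x"] gap
    by (simp add: greedy_label_def)
  ultimately show ?thesis by simp
qed

end

subsection \<open>Distances in stacked books\<close>

definition star_dist :: "nat \<Rightarrow> nat \<Rightarrow> nat" where
  "star_dist c c' = (if c = c' then 0 else of_bool (c \<noteq> 0) + of_bool (c' \<noteq> 0))"

definition path_dist :: "nat \<Rightarrow> nat \<Rightarrow> nat" where
  "path_dist p p' = (p - p') + (p' - p)"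

definition book_dist :: "nat \<times> nat \<Rightarrow> nat \<times> nat \<Rightarrow> nat" where
  "book_dist u v = star_dist (fst u) (fst v) + path_dist (snd u) (snd v)"

lemma distance_function_star_graph:
  assumes "c' < m"
  shows "distance_function (star_graph m) c' (\<lambda>c. star_dist c c')"
  unfolding distance_function_def
proof (intro conjI ballI impI)
  fix c assume "c \<in> pverts (star_graph m)" "c \<noteq> c'"
  then show "\<exists>w. (c, w) \<in> parcs (star_graph m) \<and> star_dist c c' = Suc (star_dist w c')"
    using assms
    by (intro exI[of _ "if c = 0 then c' else 0"]) (auto simp: star_graph_def star_dist_def)
qed (auto simp: star_graph_def star_dist_def)

lemma distance_function_path_graph:
  assumes "p' < n"
  shows "distance_function (path_graph n) p' (\<lambda>p. path_dist p p')"
  unfolding distance_function_def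
proof (intro conjI ballI impI)
  fix p assume "p \<in> pverts (path_graph n)" "p \<noteq> p'"
  then show "\<exists>w. (p, w) \<in> parcs (path_graph n) \<and> path_dist p p' = Suc (path_dist w p')"
    using assms
    by (intro exI[of _ "if p < p' then Suc p else p - 1"]) (auto simp: path_graph_def path_dist_def)
qed (auto simp: path_graph_def path_dist_def)

lemma pverts_stacked_book: "pverts (stacked_book m n) = {0..<m} \<times> {0..<n}"
  by (simp add: stacked_book_def cartesian_product_def star_graph_def path_graph_def)

lemma distance_function_stacked_book:
  assumes "v \<in> pverts (stacked_book m n)"
  shows "distance_function (stacked_book m n) v (\<lambda>u. book_dist u v)"
proof (cases v)
  case (Pair c p)
  then have "c < m" "p < n" using assms by (simp_all add: pverts_stacked_book)
  from distance_function_cartesian_product[OF distance_function_star_graph[OF this(1)]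
      distance_function_path_graph[OF this(2)]]
  show ?thesis by (simp add: Pair stacked_book_def book_dist_def case_prod_unfold)
qed

lemma graph_dist_stacked_book:
  assumes "u \<in> pverts (stacked_book m n)" "v \<in> pverts (stacked_book m n)"
  shows "graph_dist (stacked_book m n) u v = book_dist u v"
proof -
  interpret pair_graph "stacked_book m n" by (rule pair_graph_stacked_book)
  show ?thesis
    using graph_dist_eq_distance_function distance_function_stacked_book assms by blast
qed

lemma strongly_connected_stacked_book:
  assumes "m > 0" "n > 0"
  shows "strongly_connected (with_proj (stacked_book m n))"
proof -
  interpret pair_graph "stacked_book m n" by (rule pair_graph_stacked_book)
  show ?thesis
  proof
    show "verts (with_proj (stacked_book m n)) \<noteq> {}" using assms by (simp add: pverts_stacked_book)
    show "u \<rightarrow>\<^sup>*\<^bsub>with_proj (stacked_book m n)\<^esub> v"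
      if "u \<in> verts (with_proj (stacked_book m n))" "v \<in> verts (with_proj (stacked_book m n))"
      for u v
      using that distance_function_imp_awalk[OF distance_function_stacked_book, of v u]
      by (auto simp: reachable_awalk)
  qed
qed

lemma graph_diam_stacked_book:
  assumes "m \<ge> 3" "n > 0"
  shows "graph_diam (stacked_book m n) = n + 1"
  unfolding graph_diam_def
proof (rule Max_eqI)
  let ?V = "pverts (stacked_book m n)"
  let ?D = "{graph_dist (stacked_book m n) u v | u v. u \<in> ?V \<and> v \<in> ?V}"
  have "?D = (\<lambda>(u, v). graph_dist (stacked_book m n) u v) ` (?V \<times> ?V)" by auto
  then show "finite ?D" by (simp add: pverts_stacked_book)
  show "d \<le> n + 1" if d: "d \<in> ?D" for d
  proof -
    obtain u v where uv: "u \<in> ?V" "v \<in> ?V" "d = graph_dist (stacked_book m n) u v"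
      using d by blast
    have "star_dist (fst u) (fst v) \<le> 2" by (simp add: star_dist_def)
    moreover have "path_dist (snd u) (snd v) \<le> n - 1"
      using uv(1,2) by (auto simp: pverts_stacked_book path_dist_def)
    ultimately show ?thesis using uv assms(2) by (simp add: graph_dist_stacked_book book_dist_def)
  qed
  have ends: "(1, 0) \<in> ?V" "(2, n - 1) \<in> ?V" using assms by (auto simp: pverts_stacked_book)
  then have "n + 1 = graph_dist (stacked_book m n) (1, 0) (2, n - 1)"
    using assms(2) by (simp add: graph_dist_stacked_book book_dist_def star_dist_def path_dist_def)
  with ends show "n + 1 \<in> ?D" by blast
qed

definition level_dist :: "nat \<Rightarrow> nat \<Rightarrow> nat" where
  "level_dist k p = (if p < k then k - 1 - p else p - k)"

definition central_dist :: "nat \<Rightarrow> nat \<times> nat \<Rightarrow> nat" where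
  "central_dist k v = of_bool (fst v \<noteq> 0) + level_dist k (snd v)"

lemma star_dist_eq_if_no_common_leaf:
  assumes "c = c' \<Longrightarrow> c = 0"
  shows "star_dist c c' = of_bool (c \<noteq> 0) + of_bool (c' \<noteq> 0)"
  using assms by (auto simp: star_dist_def)

lemma book_dist_across:
  assumes "snd u < k \<longleftrightarrow> k \<le> snd v" "fst u = fst v \<Longrightarrow> fst u = 0"
  shows "book_dist u v = central_dist k u + central_dist k v + 1"
  using assms(1)
  by (auto simp: book_dist_def star_dist_eq_if_no_common_leaf[OF assms(2)] path_dist_def
      central_dist_def level_dist_def)

lemma sum_level_dist: "(\<Sum>p = 0..<2 * k. level_dist k p) = k * (k - 1)"
proof -
  have gauss: "2 * (\<Sum>p<k. p) = k * (k - 1)" for k :: nat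
    by (induction k) (auto simp: algebra_simps)
  have "(\<Sum>p = 0..<2 * k. level_dist k p)
      = (\<Sum>p = 0..<k. level_dist k p) + (\<Sum>p = k..<2 * k. level_dist k p)"
    by (rule sum.atLeastLessThan_concat[symmetric]) simp_all
  also have "(\<Sum>p = 0..<k. level_dist k p) = (\<Sum>p<k. p)"
    using sum.nat_diff_reindex[of "\<lambda>p. p" k] by (simp add: level_dist_def lessThan_atLeast0)
  also have "(\<Sum>p = k..<2 * k. level_dist k p) = (\<Sum>p<k. p)"
    using sum.shift_bounds_nat_ivl[of "level_dist k" 0 k k]
    by (simp add: level_dist_def lessThan_atLeast0 mult_2)
  finally show ?thesis using gauss[of k] by simp
qed

lemma sum_central_dist_stacked_book:
  "(\<Sum>v \<in> pverts (stacked_book m (2 * k)). central_dist k v) = 2 * k * (m - 1) + m * (k * (k - 1))"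
proof -
  have "{0..<m} \<inter> Collect ((<) 0) = {1..<m}" by auto
  then have leaves: "(\<Sum>c = 0..<m. of_bool (c \<noteq> 0)) = m - 1" by simp
  have "(\<Sum>v \<in> pverts (stacked_book m (2 * k)). central_dist k v)
      = (\<Sum>c = 0..<m. \<Sum>p = 0..<2 * k. of_bool (c \<noteq> 0) + level_dist k p)"
    by (simp add: pverts_stacked_book sum.cartesian_product central_dist_def case_prod_unfold)
  also have "\<dots> = 2 * k * (\<Sum>c = 0..<m. of_bool (c \<noteq> 0)) + m * (\<Sum>p = 0..<2 * k. level_dist k p)"
    by (simp only: sum.distrib sum_constant sum_distrib_left card_atLeastLessThan diff_zero
        of_nat_id)
  finally show ?thesis by (simp only: leaves sum_level_dist)
qed

subsection \<open>The ordering of the vertices\<close>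

text \<open>
  The shift by two avoids the leaves that the other side visits immediately before and after;
  the last two pages are exchanged so that each level ends at its centre.
\<close>

definition lower_page :: "nat \<Rightarrow> nat \<Rightarrow> nat" where
  "lower_page m j = (if j + 2 < m then j + 2 else m - 1 - j)"

definition upper_vertex :: "nat \<Rightarrow> nat \<Rightarrow> nat \<Rightarrow> nat \<times> nat" where
  "upper_vertex m k i = (i mod m, k + i div m)"

definition lower_vertex :: "nat \<Rightarrow> nat \<Rightarrow> nat \<times> nat" where
  "lower_vertex m i = (lower_page m (i mod m), i div m)"

definition visit :: "nat \<Rightarrow> nat \<Rightarrow> nat \<Rightarrow> nat \<times> nat" where
  "visit m k t = (if even t then upper_vertex m k (t div 2) else lower_vertex m (t div 2))"

lemma nat_double_cases:
  fixes t :: nat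
  obtains (even) i where "t = 2 * i" | (odd) i where "t = Suc (2 * i)"
  by (metis evenE oddE Suc_eq_plus1)

lemma lower_page_less: "m \<ge> 2 \<Longrightarrow> j < m \<Longrightarrow> lower_page m j < m"
  by (auto simp: lower_page_def)

lemma lower_page_last: "m \<ge> 2 \<Longrightarrow> Suc j = m \<Longrightarrow> lower_page m j = 0"
  by (auto simp: lower_page_def)

lemma fst_visit_Suc_eq_imp_0:
  assumes "m \<ge> 4" "fst (visit m k t) = fst (visit m k (Suc t))"
  shows "fst (visit m k t) = 0"
proof (cases t rule: nat_double_cases)
  case (even i)
  with assms show ?thesis
    by (auto simp: visit_def upper_vertex_def lower_vertex_def lower_page_def split: if_splits)
next
  case (odd i)
  have "i mod m < m" using assms(1) by simp
  with odd assms show ?thesis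
    by (auto simp: visit_def upper_vertex_def lower_vertex_def lower_page_def mod_Suc
        split: if_splits)
qed

lemma fst_visit_add_2_neq:
  assumes "m \<ge> 4"
  shows "fst (visit m k t) \<noteq> fst (visit m k (t + 2))"
proof -
  define next_page where "next_page j = (if Suc j = m then 0 else Suc j)" for j
  have Suc_mod: "Suc i mod m = next_page (i mod m)" for i by (simp add: mod_Suc next_page_def)
  have "j \<noteq> next_page j" "j < m \<Longrightarrow> lower_page m j \<noteq> lower_page m (next_page j)" for j
    using assms by (auto simp: next_page_def lower_page_def)
  then show ?thesis using assms by (simp add: visit_def upper_vertex_def lower_vertex_def Suc_mod)
qed

lemma div_2_div_less:
  fixes m k t :: nat
  assumes "t < 2 * (m * k)"
  shows "t div 2 div m < k"
proof -
  have "m > 0" using assms by (cases m) auto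
  then show ?thesis using assms by (simp add: div_less_iff_less_mult mult.commute)
qed

lemma visit_mem:
  assumes "m \<ge> 2" "t < 2 * (m * k)"
  shows "visit m k t \<in> pverts (stacked_book m (2 * k))"
  using div_2_div_less[OF assms(2)] lower_page_less[OF assms(1)] assms(1)
  by (simp add: pverts_stacked_book visit_def upper_vertex_def lower_vertex_def)

lemma visit_onto:
  assumes "m \<ge> 2" "c < m" "p < 2 * k"
  shows "(c, p) \<in> visit m k ` {..<2 * (m * k)}"
proof -
  have bound: "m * a + j < m * k" if "a < k" "j < m" for a j
    using that by (simp add: mult.commute[of m k] flip: div_less_iff_less_mult)
  show ?thesis
  proof (cases "k \<le> p")
    case True
    let ?i = "m * (p - k) + c"
    have "visit m k (2 * ?i) = (c, p)" using True assms by (simp add: visit_def upper_vertex_def)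
    moreover have "?i < m * k" using bound True assms by simp
    ultimately show ?thesis by (intro image_eqI[of _ _ "2 * ?i"]) auto
  next
    case False
    define j where "j = (if c \<ge> 2 then c - 2 else m - 1 - c)"
    have j: "j < m" "lower_page m j = c" using assms by (auto simp: j_def lower_page_def)
    let ?i = "m * p + j"
    have "visit m k (Suc (2 * ?i)) = (c, p)" using j assms by (simp add: visit_def lower_vertex_def)
    moreover have "?i < m * k" using bound j False by simp
    ultimately show ?thesis by (intro image_eqI[of _ _ "Suc (2 * ?i)"]) auto
  qed
qed

lemma bij_betw_visit:
  assumes "m \<ge> 2"
  shows "bij_betw (visit m k) {..<2 * (m * k)} (pverts (stacked_book m (2 * k)))"
proof -
  have image: "visit m k ` {..<2 * (m * k)} = pverts (stacked_book m (2 * k))"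
  proof
    show "visit m k ` {..<2 * (m * k)} \<subseteq> pverts (stacked_book m (2 * k))"
      using visit_mem[OF assms] by auto
    show "pverts (stacked_book m (2 * k)) \<subseteq> visit m k ` {..<2 * (m * k)}"
      using visit_onto[OF assms] by (auto simp: pverts_stacked_book)
  qed
  moreover have "inj_on (visit m k) {..<2 * (m * k)}"
    by (rule eq_card_imp_inj_on) (simp_all add: image pverts_stacked_book)
  ultimately show ?thesis by (simp add: bij_betw_def)
qed

lemma graph_dist_visit:
  assumes "m \<ge> 2" "s < 2 * (m * k)" "t < 2 * (m * k)"
  shows "graph_dist (stacked_book m (2 * k)) (visit m k s) (visit m k t)
    = book_dist (visit m k s) (visit m k t)"
  using assms by (simp add: graph_dist_stacked_book visit_mem)

lemma central_dist_upper_vertex: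
  "central_dist k (upper_vertex m k i) = of_bool (i mod m \<noteq> 0) + i div m"
  by (simp add: central_dist_def level_dist_def upper_vertex_def)

lemma central_dist_lower_vertex:
  "i div m < k \<Longrightarrow>
    central_dist k (lower_vertex m i) = of_bool (lower_page m (i mod m) \<noteq> 0) + (k - 1 - i div m)"
  by (simp add: central_dist_def level_dist_def lower_vertex_def)

lemma central_dist_upper_vertex_le: "central_dist k (upper_vertex m k i) \<le> i div m + 1"
  by (simp add: central_dist_upper_vertex)

lemma central_dist_lower_vertex_le: "i div m < k \<Longrightarrow> central_dist k (lower_vertex m i) \<le> k - i div m"
  by (auto simp: central_dist_lower_vertex)

lemma book_dist_visit_Suc:
  assumes "m \<ge> 4" "Suc t < 2 * (m * k)"
  shows "book_dist (visit m k t) (visit m k (Suc t))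
    = central_dist k (visit m k t) + central_dist k (visit m k (Suc t)) + 1"
proof (rule book_dist_across)
  show "snd (visit m k t) < k \<longleftrightarrow> k \<le> snd (visit m k (Suc t))"
    using assms(2) div_2_div_less[of t m k] div_2_div_less[of "Suc t" m k]
    by (auto simp: visit_def upper_vertex_def lower_vertex_def)
qed (rule fst_visit_Suc_eq_imp_0[OF assms(1)])

lemma central_dist_visit_Suc_le:
  assumes "m \<ge> 2" "Suc t < 2 * (m * k)"
  shows "central_dist k (visit m k t) + central_dist k (visit m k (Suc t)) \<le> k + 1"
proof (cases t rule: nat_double_cases)
  case (even i)
  then have "i div m < k" using div_2_div_less[OF assms(2)] by simp
  with central_dist_lower_vertex_le[OF this] central_dist_upper_vertex_le[of k m i]
  show ?thesis by (simp add: even visit_def)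
next
  case (odd i)
  then have less: "i div m < k" using div_2_div_less[of t m k] assms(2) by simp
  show ?thesis
  proof (cases "Suc (i mod m) = m")
    case True
    then have "Suc i mod m = 0" "Suc i div m = Suc (i div m)" by (simp_all add: mod_Suc div_Suc)
    with less lower_page_last[OF assms(1) True] show ?thesis
      by (simp add: odd visit_def central_dist_upper_vertex central_dist_lower_vertex)
  next
    case False
    then have "Suc i div m = i div m" by (simp add: mod_Suc div_Suc)
    with less central_dist_lower_vertex_le[OF less] central_dist_upper_vertex_le[of k m "Suc i"]
    show ?thesis by (simp add: odd visit_def)
  qed
qed

lemma level_dist_visit_add_2_le:
  assumes "t + 2 < 2 * (m * k)"
  shows "level_dist k (snd (visit m k t)) + 2 * central_dist k (visit m k (t + 1))
      + level_dist k (snd (visit m k (t + 2)))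
    \<le> 2 * k + path_dist (snd (visit m k t)) (snd (visit m k (t + 2)))"
proof -
  have level_Suc: "\<exists>q. Suc i div m = i div m + q" for i
    using div_le_mono[of i "Suc i" m] by (simp add: le_iff_add)
  show ?thesis
  proof (cases t rule: nat_double_cases)
    case (even i)
    then have less: "i div m < k" using div_2_div_less[of t m k] assms by simp
    obtain q where "Suc i div m = i div m + q" using level_Suc by blast
    then show ?thesis using less central_dist_lower_vertex_le[OF less]
      by (simp add: even visit_def level_dist_def path_dist_def upper_vertex_def)
  next
    case (odd i)
    then have less: "Suc i div m < k" using div_2_div_less[OF assms] by simp
    obtain q where "Suc i div m = i div m + q" using level_Suc by blast
    then show ?thesis using less central_dist_upper_vertex_le[of k m "Suc i"]
      by (simp add: odd visit_def level_dist_def path_dist_def lower_vertex_def)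
  qed
qed

lemma central_dist_visit_add_2_le:
  assumes "m \<ge> 4" "t + 2 < 2 * (m * k)"
  shows "central_dist k (visit m k t) + 2 * central_dist k (visit m k (t + 1))
      + central_dist k (visit m k (t + 2))
    \<le> 2 * k + book_dist (visit m k t) (visit m k (t + 2))"
proof -
  let ?u = "visit m k t" and ?v = "visit m k (t + 2)"
  have "book_dist ?u ?v = of_bool (fst ?u \<noteq> 0) + of_bool (fst ?v \<noteq> 0) + path_dist (snd ?u) (snd ?v)"
    unfolding book_dist_def
    by (subst star_dist_eq_if_no_common_leaf) (use fst_visit_add_2_neq[OF assms(1)] in auto)
  then show ?thesis
    using level_dist_visit_add_2_le[OF assms(2)] central_dist_def[of k ?u] central_dist_def[of k ?v]
    by linarith
qed

lemma central_dist_visit_first: "central_dist k (visit m k 0) = 0"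
  by (simp add: visit_def central_dist_upper_vertex)

lemma central_dist_visit_last:
  assumes "m \<ge> 2" "k \<ge> 1"
  shows "central_dist k (visit m k (2 * (m * k) - 1)) = 0"
proof -
  let ?i = "m * (k - 1) + (m - 1)"
  have "m * k = m * (k - 1) + m" using assms(2) by (cases k) auto
  then have "2 * (m * k) - 1 = Suc (2 * ?i)" using assms(1) by simp
  then have "visit m k (2 * (m * k) - 1) = lower_vertex m ?i" by (simp add: visit_def)
  moreover have "?i div m = k - 1" "?i mod m = m - 1"
    using assms(1) by (simp_all del: add_diff_assoc diff_Suc_1)
  ultimately show ?thesis
    using assms lower_page_last[of m "m - 1"] by (simp add: central_dist_lower_vertex)
qed

lemma radio_number_stacked_book_le_central_dist:
  assumes "m \<ge> 4" "k \<ge> 1"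
  shows "radio_number (stacked_book m (2 * k))
      + 2 * (\<Sum>v \<in> pverts (stacked_book m (2 * k)). central_dist k v)
    \<le> (2 * (m * k) - 1) * (2 * k + 1)"
proof -
  let ?G = "stacked_book m (2 * k)" and ?N = "2 * (m * k) - 1" and ?x = "visit m k"
  interpret pair_graph ?G by (rule pair_graph_stacked_book)
  have diam: "graph_diam ?G = 2 * k + 1" using assms by (simp add: graph_diam_stacked_book)
  have "2 * (m * k) > 0" using assms by simp
  then have le_N: "t \<le> ?N \<longleftrightarrow> t < 2 * (m * k)" for t by linarith
  have "radio_number ?G + 2 * (\<Sum>v \<in> pverts ?G. central_dist k v)
      \<le> ?N * graph_diam ?G + central_dist k (?x 0) + central_dist k (?x ?N)"
  proof (rule radio_number_le_weighted_ordering)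
    show "strongly_connected (with_proj ?G)"
      using assms by (simp add: strongly_connected_stacked_book)
    have "{..?N} = {..<2 * (m * k)}" using le_N by auto
    then show "bij_betw ?x {..?N} (pverts ?G)" using bij_betw_visit[of m k] assms by simp
    show "graph_dist ?G (?x t) (?x (Suc t))
        = central_dist k (?x t) + central_dist k (?x (Suc t)) + 1" if "t < ?N" for t
      using that assms by (simp add: graph_dist_visit book_dist_visit_Suc)
    show "central_dist k (?x t) + central_dist k (?x (Suc t)) + k \<le> graph_diam ?G"
      if "t < ?N" for t
      using central_dist_visit_Suc_le[of m t k] that assms(1) diam by simp
    show "graph_diam ?G \<le> 3 * k" using diam assms(2) by simp
    show "central_dist k (?x t) + 2 * central_dist k (?x (t + 1)) + central_dist k (?x (t + 2)) + 1
        \<le> graph_diam ?G + graph_dist ?G (?x t) (?x (t + 2))" if "t + 2 \<le> ?N" for t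
      using central_dist_visit_add_2_le[OF assms(1)] that[unfolded le_N] assms(1) diam
      by (simp add: graph_dist_visit)
  qed
  then show ?thesis
    using assms by (simp add: diam central_dist_visit_first central_dist_visit_last[simplified])
qed

lemma radio_number_stacked_book_even_le:
  assumes "m \<ge> 4" "k \<ge> 1"
  shows "real (radio_number (stacked_book m (2 * k))) \<le> 2 * real m * (real k)\<^sup>2 + 2 * real k - 1"
proof -
  have "radio_number (stacked_book m (2 * k)) + 2 * (2 * k * (m - 1) + m * (k * (k - 1)))
      \<le> (2 * (m * k) - 1) * (2 * k + 1)"
    using radio_number_stacked_book_le_central_dist[OF assms]
    by (simp add: sum_central_dist_stacked_book)
  then have "real (radio_number (stacked_book m (2 * k)))
        + 2 * (2 * real k * real (m - 1) + real m * (real k * real (k - 1)))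
      \<le> real (2 * (m * k) - 1) * (2 * real k + 1)"
    by (simp only: of_nat_add of_nat_mult of_nat_1 of_nat_numeral
        flip: of_nat_le_iff[where 'a = real])
  moreover have "real (m - 1) = real m - 1" "real (k - 1) = real k - 1"
    "real (2 * (m * k) - 1) = 2 * real m * real k - 1"
    using assms by (simp_all add: of_nat_diff)
  ultimately show ?thesis by (simp add: power2_eq_square algebra_simps)
qed

theorem theorem3p9:
  fixes m n :: nat
  assumes "m \<ge> 3" and "even m" and "n > 0" and "even n"
  shows "real (radio_number (stacked_book m n)) \<le> real m * (real n)\<^sup>2 / 2 + real n - 1"
proof -
  obtain k where n: "n = 2 * k" using \<open>even n\<close> by blast
  have "m \<ge> 4" using \<open>m \<ge> 3\<close> \<open>even m\<close> by (cases "m = 3") auto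
  moreover have "k \<ge> 1" using \<open>n > 0\<close> n by simp
  ultimately have "real (radio_number (stacked_book m n))
      \<le> 2 * real m * (real k)\<^sup>2 + 2 * real k - 1"
    unfolding n by (rule radio_number_stacked_book_even_le)
  also have "\<dots> = real m * (real n)\<^sup>2 / 2 + real n - 1"
    by (simp add: n power2_eq_square)
  finally show ?thesis .
qed

end
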